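(* Let $X$ be a $\sigma$-compact, locally compact Hausdorff space, and let $A$ be a $\sigma$-complete subalgebra of $\mathrm{C}(X)$ which separates points of $X$. Let $L:A\to\mathbb{R}$ be a positive linear functional. Then there exists a Radon measure $\mu$ on $X$ with compact support such that $L(f)=\int_X f\,d\mu$ for all $f\in A$.
   Context: $\mathrm{C}(X)$ is the algebra of all continuous real-valued functions on $X$. A subalgebra $A\subseteq\mathrm{C}(X)$ is $\sigma$-complete if for every sequence $(b_n)_{n\in\mathbb{N}}$ in $A$, whenever the sum $b=\sum_n b_n$ exists in $\mathrm{C}(X)$ (the series converges pointwise on $X$ to an element $b$ of $\mathrm{C}(X)$), one has $b\in A$. A linear functional $L:A\to\mathbb{R}$ is positive if $L(f)\ge 0$ for every $f\in A$ with $f(x)\ge0$ for all $x\in X$. *)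

theory Defs
  imports "HOL-Analysis.Analysis"
begin

definition sigma_compact :: "'a::topological_space set \<Rightarrow> bool"
  where "sigma_compact S \<longleftrightarrow> (\<exists>K :: nat \<Rightarrow> 'a set. (\<forall>n. compact (K n)) \<and> (\<Union>n. K n) = S)"

definition continuous_functions :: "('a::topological_space \<Rightarrow> real) set"
  where "continuous_functions = {f. continuous_on UNIV f}"

(* A subalgebra is not required to contain the constant functions. *)
definition subalgebra_of_C :: "('a::topological_space \<Rightarrow> real) set \<Rightarrow> bool"
  where "subalgebra_of_C A \<longleftrightarrow>
    A \<subseteq> continuous_functions \<and>
    (\<lambda>x. 0) \<in> A \<and>
    (\<forall>f\<in>A. \<forall>g\<in>A. (\<lambda>x. f x + g x) \<in> A) \<and>
    (\<forall>c. \<forall>f\<in>A. (\<lambda>x. c * f x) \<in> A) \<and>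
    (\<forall>f\<in>A. \<forall>g\<in>A. (\<lambda>x. f x * g x) \<in> A)"

definition sigma_complete :: "('a::topological_space \<Rightarrow> real) set \<Rightarrow> bool"
  where "sigma_complete A \<longleftrightarrow>
    (\<forall>(b :: nat \<Rightarrow> 'a \<Rightarrow> real) s.
      (\<forall>n. b n \<in> A) \<and> s \<in> continuous_functions \<and> (\<forall>x. (\<lambda>n. b n x) sums s x) \<longrightarrow> s \<in> A)"

definition separates_points :: "('a \<Rightarrow> real) set \<Rightarrow> bool"
  where "separates_points A \<longleftrightarrow> (\<forall>x y. x \<noteq> y \<longrightarrow> (\<exists>f\<in>A. f x \<noteq> f y))"

(* The values of L outside A are irrelevant in the next two definitions. *)
definition linear_functional_on :: "('a \<Rightarrow> real) set \<Rightarrow> (('a \<Rightarrow> real) \<Rightarrow> real) \<Rightarrow> bool"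
  where "linear_functional_on A L \<longleftrightarrow>
    (\<forall>f\<in>A. \<forall>g\<in>A. L (\<lambda>x. f x + g x) = L f + L g) \<and>
    (\<forall>c. \<forall>f\<in>A. L (\<lambda>x. c * f x) = c * L f)"

definition positive_on :: "('a \<Rightarrow> real) set \<Rightarrow> (('a \<Rightarrow> real) \<Rightarrow> real) \<Rightarrow> bool"
  where "positive_on A L \<longleftrightarrow> (\<forall>f\<in>A. (\<forall>x. 0 \<le> f x) \<longrightarrow> 0 \<le> L f)"

(* Borel measure, finite on compact sets and inner regular on all Borel sets. *)
definition radon_measure :: "'a::t2_space measure \<Rightarrow> bool"
  where "radon_measure M \<longleftrightarrow>
    sets M = sets borel \<and>
    (\<forall>K. compact K \<longrightarrow> emeasure M K < \<infinity>) \<and>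
    (\<forall>B\<in>sets borel. emeasure M B = (SUP K\<in>{K. compact K \<and> K \<subseteq> B}. emeasure M K))"

(* The complement of the union of all open null sets; for a Radon measure that union is
   itself a null set, so this is the smallest closed set with null complement. *)
definition measure_support :: "'a::topological_space measure \<Rightarrow> 'a set"
  where "measure_support M = - \<Union>{U. open U \<and> emeasure M U = 0}"

end

theory Submission
  imports Defs
begin

text \<open>By the Stone-Weierstrass theorem on the compact sets exhausting \<open>X\<close>, every continuous function
  is a pointwise limit of functions \<open>g + c\<close> with \<open>g \<in> A\<close> and \<open>c\<close> constant; as \<open>A\<close> is closed under
  pointwise sequential limits that are continuous, it is either all of \<open>C(X)\<close> or the set of all
  continuous functions vanishing at one point. In both cases \<open>L\<close> extends to a positive functional
  on \<open>C(X)\<close>. Such a functional lives on a compact set: otherwise a locally finite sum of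
  nonnegative functions would have infinite value. The measure is then given by the Riesz
  representation theorem, obtained from Caratheodory's construction.\<close>

section \<open>Two elementary estimates\<close>

text \<open>Errors below come as \<open>d\<close> times a fixed total such as
  \<open>L (\<lambda>x. 1)\<close>, which may be zero; hence the choice of
  \<open>e / (c + 1)\<close> for \<open>d\<close>.\<close>

lemma ennreal_le_add_small:
  fixes x y :: ennreal
  assumes "0 \<le> c" and le: "\<And>d. 0 < d \<Longrightarrow> x \<le> y + ennreal (d * c)"
  shows "x \<le> y"
proof (rule ennreal_le_epsilon)
  fix e :: real assume "0 < e"
  have "x \<le> y + ennreal (e / (c + 1) * c)"
    using \<open>0 < e\<close> \<open>0 \<le> c\<close> by (intro le) simp
  also have "e / (c + 1) * c \<le> e"
    using \<open>0 < e\<close> \<open>0 \<le> c\<close> by (simp add: field_simps)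
  finally show "x \<le> y + ennreal e"
    by (meson add_left_mono ennreal_leI order_trans)
qed

text \<open>The summand for \<open>k\<close> is the length of the part of \<open>[0, y]\<close>
  between the heights \<open>k\<close> and \<open>k + 1\<close>.\<close>

lemma sum_slices:
  fixes y :: real
  assumes "0 \<le> y"
  shows "(\<Sum>k<n. min 1 (max 0 (y - real k))) = min y (real n)"
  using assms by (induction n) auto

section \<open>Positive functionals that depend only on a compact set\<close>

text \<open>Positivity is tested on \<open>K\<close> alone, which forces \<open>L f\<close> to
  depend only on the restriction of \<open>f\<close> to \<open>K\<close>. The assumption
  \<open>bump\<close> is complete regularity, the form in which local compactness of the space
  enters.\<close>

locale concentrated_functional =
  fixes L :: "('a::t2_space \<Rightarrow> real) \<Rightarrow> real" and K :: "'a set"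
  assumes add: "continuous_on UNIV f \<Longrightarrow> continuous_on UNIV g \<Longrightarrow> L (\<lambda>x. f x + g x) = L f + L g"
    and scale: "continuous_on UNIV f \<Longrightarrow> L (\<lambda>x. c * f x) = c * L f"
    and nonneg: "continuous_on UNIV f \<Longrightarrow> (\<And>x. x \<in> K \<Longrightarrow> 0 \<le> f x) \<Longrightarrow> 0 \<le> L f"
    and compact: "compact K"
    and bump: "open (U :: 'a set) \<Longrightarrow> x \<in> U \<Longrightarrow>
      \<exists>f. continuous_on UNIV f \<and> (\<forall>y. 0 \<le> f y \<and> f y \<le> (1 :: real)) \<and> (\<forall>y. y \<notin> U \<longrightarrow> f y = 0) \<and> f x = 1"
begin

lemma diff: "continuous_on UNIV f \<Longrightarrow> continuous_on UNIV g \<Longrightarrow> L (\<lambda>x. f x - g x) = L f - L g"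
  using add[of f "\<lambda>x. -1 * g x"] scale[of g "-1"] by (simp add: continuous_on_minus)

lemma mono:
  assumes "continuous_on UNIV f" "continuous_on UNIV g" "\<And>x. x \<in> K \<Longrightarrow> f x \<le> g x"
  shows "L f \<le> L g"
  using nonneg[of "\<lambda>x. g x - f x"] assms by (simp add: diff continuous_on_diff)

lemma cong:
  assumes "continuous_on UNIV f" "continuous_on UNIV g" "\<And>x. x \<in> K \<Longrightarrow> f x = g x"
  shows "L f = L g"
  using assms by (intro antisym mono) auto

lemma zero: "L (\<lambda>x. 0) = 0"
  using scale[of "\<lambda>x. 0" 0] by simp

lemma const: "L (\<lambda>x. c) = c * L (\<lambda>x. 1)"
  using scale[of "\<lambda>x. 1" c] by simp

lemma sum:
  assumes "\<And>i. i \<in> I \<Longrightarrow> continuous_on UNIV (f i)"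
  shows "L (\<lambda>x. \<Sum>i\<in>I. f i x) = (\<Sum>i\<in>I. L (f i))"
proof (cases "finite I")
  case True
  then show ?thesis
    using assms by induction (simp_all add: zero add continuous_on_sum)
qed (simp add: zero)

lemma one_nonneg: "0 \<le> L (\<lambda>x. 1)"
  by (rule nonneg) auto

section \<open>Mass of open sets and the induced outer measure\<close>

text \<open>Unlike in the usual Riesz construction, the closed support need not lie inside
  \<open>U\<close>; it is enough that the function vanishes off \<open>U\<close>. The lemma
  \<open>truncate\<close> makes up for this.\<close>

definition below :: "'a set \<Rightarrow> ('a \<Rightarrow> real) set"
  where "below U = {f. continuous_on UNIV f \<and> (\<forall>x. 0 \<le> f x \<and> f x \<le> 1) \<and> (\<forall>x. x \<notin> U \<longrightarrow> f x = 0)}"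

definition open_mass :: "'a set \<Rightarrow> ennreal"
  where "open_mass U = (SUP f\<in>below U. ennreal (L f))"

definition outer_mass :: "'a set \<Rightarrow> ennreal"
  where "outer_mass E = (INF U\<in>{U. open U \<and> E \<subseteq> U}. open_mass U)"

lemma belowD:
  assumes "f \<in> below U"
  shows "continuous_on UNIV f" "0 \<le> f x" "f x \<le> 1" "x \<notin> U \<Longrightarrow> f x = 0" "0 \<le> L f"
  using assms nonneg by (auto simp: below_def)

lemma belowI:
  assumes "continuous_on UNIV f" "\<And>x. 0 \<le> f x" "\<And>x. f x \<le> 1" "\<And>x. x \<notin> U \<Longrightarrow> f x \<le> 0"
  shows "f \<in> below U"
  using assms by (auto simp: below_def intro: antisym)

lemma zero_below: "(\<lambda>x. 0) \<in> below U"
  by (simp add: below_def)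

text \<open>The truncation is zero wherever \<open>f \<le> d\<close>, which leaves room for another
  function there, and it lowers the functional by at most \<open>d\<close> times the total
  mass.\<close>

lemma truncate:
  assumes f: "f \<in> below U" and "0 \<le> d"
  shows "(\<lambda>x. max 0 (f x - d)) \<in> below U" "L f \<le> L (\<lambda>x. max 0 (f x - d)) + d * L (\<lambda>x. 1)"
proof -
  have cont: "continuous_on UNIV (\<lambda>x. max 0 (f x - d))"
    by (intro continuous_intros belowD[OF f])
  then show "(\<lambda>x. max 0 (f x - d)) \<in> below U"
    using belowD[OF f] \<open>0 \<le> d\<close> by (intro belowI) (auto simp: add_increasing2 diff_le_eq)
  have "L f \<le> L (\<lambda>x. max 0 (f x - d) + d)"
    by (intro mono continuous_on_add cont belowD[OF f]) auto
  also have "\<dots> = L (\<lambda>x. max 0 (f x - d)) + d * L (\<lambda>x. 1)"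
    using cont by (simp add: add const[of d])
  finally show "L f \<le> L (\<lambda>x. max 0 (f x - d)) + d * L (\<lambda>x. 1)" .
qed

lemma open_mass_upper: "f \<in> below U \<Longrightarrow> ennreal (L f) \<le> open_mass U"
  unfolding open_mass_def by (rule SUP_upper)

lemma open_mass_least: "(\<And>f. f \<in> below U \<Longrightarrow> ennreal (L f) \<le> c) \<Longrightarrow> open_mass U \<le> c"
  unfolding open_mass_def by (rule SUP_least)

lemma open_mass_mono: "U \<subseteq> V \<Longrightarrow> open_mass U \<le> open_mass V"
  unfolding open_mass_def below_def
  by (intro SUP_subset_mono) auto

lemma open_mass_UNIV: "open_mass UNIV = ennreal (L (\<lambda>x. 1))"
proof (rule antisym)
  show "open_mass UNIV \<le> ennreal (L (\<lambda>x. 1))"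
    by (intro open_mass_least ennreal_leI mono) (auto dest: belowD)
  show "ennreal (L (\<lambda>x. 1)) \<le> open_mass UNIV"
    by (intro open_mass_upper belowI) auto
qed

lemma open_mass_finite: "open_mass U < \<infinity>"
  using open_mass_mono[of U UNIV] by (simp add: open_mass_UNIV le_less_trans)

lemma open_mass_approx:
  assumes "0 < d"
  obtains f where "f \<in> below U" "open_mass U \<le> ennreal (L f) + ennreal d"
proof (cases "open_mass U = 0")
  \<comment> \<open>Mass 0 is separate because subtracting \<open>d\<close> from it in
    \<open>ennreal\<close> gives nothing strictly smaller.\<close>
  case True
  then show ?thesis using that[of "\<lambda>x. 0"] zero_below by simp
next
  case False
  then have "open_mass U - ennreal d < open_mass U"
    using \<open>0 < d\<close> open_mass_finite[of U] by (simp add: ennreal_between top.not_eq_extremum zero_less_iff_neq_zero)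
  then obtain f where "f \<in> below U" "open_mass U - ennreal d < ennreal (L f)"
    unfolding open_mass_def by (auto simp: less_SUP_iff)
  then show ?thesis
    by (intro that[of f]) (auto simp: ennreal_minus_le_iff add.commute dest!: less_imp_le)
qed

text \<open>Up to an error \<open>d\<close>, a function below the union is dominated on
  \<open>K\<close> by finitely many functions, each below a single \<open>U j\<close>. Compactness
  of the part of \<open>K\<close> where \<open>d \<le> f\<close> provides the finite cover.\<close>

lemma open_mass_UN:
  fixes U :: "nat \<Rightarrow> 'a set"
  assumes U: "\<And>i. open (U i)"
  shows "open_mass (\<Union>i. U i) \<le> (\<Sum>i. open_mass (U i))"
proof (rule open_mass_least)
  fix f assume f: "f \<in> below (\<Union>i. U i)"
  show "ennreal (L f) \<le> (\<Sum>i. open_mass (U i))"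
  proof (rule ennreal_le_add_small[OF one_nonneg])
    fix d :: real assume "0 < d"
    define K' where "K' = K \<inter> {x. d \<le> f x}"
    have "compact K'"
      unfolding K'_def by (intro compact_Int_closed compact closed_Collect_le belowD[OF f] continuous_on_const)
    have "\<exists>i g. g \<in> below (U i) \<and> g x = 1" if "x \<in> K'" for x
    proof -
      have "0 < f x" using that \<open>0 < d\<close> by (auto simp: K'_def)
      then obtain i where "x \<in> U i" using belowD(4)[OF f, of x] by force
      then show ?thesis using bump[OF U, of x i] by (auto simp: below_def)
    qed
    then obtain i g where g: "\<And>x. x \<in> K' \<Longrightarrow> g x \<in> below (U (i x))" and g1: "\<And>x. x \<in> K' \<Longrightarrow> g x x = 1"
      by metis
    have "open {y. 1 - d < g x y}" if "x \<in> K'" for x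
      by (intro open_Collect_less continuous_on_const belowD[OF g[OF that]])
    moreover have "K' \<subseteq> (\<Union>x\<in>K'. {y. 1 - d < g x y})"
      using g1 \<open>0 < d\<close> by auto
    ultimately obtain D where D: "D \<subseteq> K'" "finite D" "K' \<subseteq> (\<Union>x\<in>D. {y. 1 - d < g x y})"
      by (rule compactE_image[OF \<open>compact K'\<close>])
    \<comment> \<open>Bumps with the same index are gathered into one function per set, capped at 1
      so that it remains below \<open>U j\<close>.\<close>
    define h where "h j y = min 1 (\<Sum>x\<in>{x\<in>D. i x = j}. g x y)" for j y
    have h: "h j \<in> below (U j)" for j
    proof (rule belowI)
      show "continuous_on UNIV (h j)"
        unfolding h_def using D(1) by (intro continuous_intros) (auto intro: belowD(1)[OF g])
      show "0 \<le> h j y" for y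
        unfolding h_def using D(1) by (auto intro!: sum_nonneg belowD(2)[OF g])
      show "h j y \<le> 0" if "y \<notin> U j" for y
      proof -
        have "(\<Sum>x\<in>{x\<in>D. i x = j}. g x y) = 0"
          using D(1) that by (intro sum.neutral ballI belowD(4)[OF g]) auto
        then show ?thesis by (simp add: h_def)
      qed
    qed (simp add: h_def)
    obtain n where n: "i ` D \<subseteq> {..<n}"
      using D(2) finite_nat_iff_bounded by blast
    \<comment> \<open>Where \<open>d \<le> f\<close>, some \<open>h j\<close> exceeds
      \<open>1 - d\<close> and \<open>f \<le> 1\<close> does the rest; elsewhere \<open>d\<close>
      alone suffices.\<close>
    have "f y \<le> (\<Sum>j<n. h j y) + d" if "y \<in> K" for y
    proof (cases "d \<le> f y")
      case True
      then have "y \<in> K'"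
        using that by (simp add: K'_def)
      then obtain x where x: "x \<in> D" "1 - d < g x y"
        using D(3) by blast
      have "g x y \<le> (\<Sum>z\<in>{z\<in>D. i z = i x}. g z y)"
        using x D by (intro member_le_sum) (auto intro: belowD(2)[OF g])
      with x \<open>0 < d\<close> have "1 - d < h (i x) y"
        by (simp add: h_def)
      also have "\<dots> \<le> (\<Sum>j<n. h j y)"
        using x n by (intro member_le_sum) (auto intro: belowD(2)[OF h])
      finally show ?thesis using belowD(3)[OF f, of y] by simp
    next
      case False
      then show ?thesis using sum_nonneg[of "{..<n}" "\<lambda>j. h j y"] belowD(2)[OF h] by (simp add: add_increasing)
    qed
    then have "L f \<le> L (\<lambda>y. (\<Sum>j<n. h j y) + d)"
      by (intro mono continuous_intros belowD(1)[OF f] belowD(1)[OF h])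
    also have "\<dots> = (\<Sum>j<n. L (h j)) + d * L (\<lambda>x. 1)"
      by (subst add) (auto intro!: continuous_intros belowD(1)[OF h] simp: sum belowD(1)[OF h] const[of d])
    finally have "ennreal (L f) \<le> ennreal ((\<Sum>j<n. L (h j)) + d * L (\<lambda>x. 1))"
      by (rule ennreal_leI)
    also have "\<dots> = (\<Sum>j<n. ennreal (L (h j))) + ennreal (d * L (\<lambda>x. 1))"
      using \<open>0 < d\<close> one_nonneg belowD(5)[OF h] by (simp add: ennreal_plus sum_nonneg)
    also have "(\<Sum>j<n. ennreal (L (h j))) \<le> (\<Sum>j<n. open_mass (U j))"
      by (intro sum_mono open_mass_upper h)
    also have "\<dots> \<le> (\<Sum>j. open_mass (U j))"
      by (intro sum_le_suminf) auto
    finally show "ennreal (L f) \<le> (\<Sum>i. open_mass (U i)) + ennreal (d * L (\<lambda>x. 1))"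
      by (simp add: add_right_mono)
  qed
qed

text \<open>Nearly optimal functions for \<open>U \<inter> V\<close> and for a neighbourhood of
  \<open>U - V\<close> combine into one function below \<open>U\<close>: after truncation of the
  first they are nonzero on disjoint sets, so the sum stays at most 1.\<close>

lemma open_mass_split:
  assumes U: "open U" and V: "open V"
  shows "open_mass (U \<inter> V) + outer_mass (U - V) \<le> open_mass U"
proof (rule ennreal_le_add_small)
  \<comment> \<open>The truncation costs \<open>d * L (\<lambda>x. 1)\<close>, the two
    approximations cost \<open>d\<close> each.\<close>
  show "0 \<le> L (\<lambda>x. 1) + 2"
    using one_nonneg by simp
  fix d :: real assume "0 < d"
  obtain f where f: "f \<in> below (U \<inter> V)" "open_mass (U \<inter> V) \<le> ennreal (L f) + ennreal d"
    by (rule open_mass_approx[OF \<open>0 < d\<close>])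
  \<comment> \<open>\<open>f\<close> vanishes off \<open>V\<close>, so this open set contains
    \<open>U - V\<close>; the truncation of \<open>f\<close> is zero on it.\<close>
  define W where "W = U \<inter> {x. f x < d}"
  have "open W"
    unfolding W_def by (intro open_Int U open_Collect_less continuous_on_const belowD[OF f(1)])
  moreover have "U - V \<subseteq> W"
    using belowD(4)[OF f(1)] \<open>0 < d\<close> by (auto simp: W_def)
  ultimately have "outer_mass (U - V) \<le> open_mass W"
    unfolding outer_mass_def by (intro INF_lower) auto
  obtain g where g: "g \<in> below W" "open_mass W \<le> ennreal (L g) + ennreal d"
    by (rule open_mass_approx[OF \<open>0 < d\<close>])
  define f' where "f' x = max 0 (f x - d)" for x
  have f': "f' \<in> below (U \<inter> V)" "L f \<le> L f' + d * L (\<lambda>x. 1)"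
    using truncate[OF f(1)] \<open>0 < d\<close> by (auto simp: f'_def[abs_def])
  have sum_below: "(\<lambda>x. f' x + g x) \<in> below U"
  proof (rule belowI)
    show "continuous_on UNIV (\<lambda>x. f' x + g x)"
      by (intro continuous_on_add belowD[OF f'(1)] belowD[OF g(1)])
    show "0 \<le> f' x + g x" for x
      using belowD(2)[OF f'(1)] belowD(2)[OF g(1)] by simp
    show "f' x + g x \<le> 1" for x
      using belowD(3,4)[OF f'(1), of x] belowD(3,4)[OF g(1), of x] by (cases "f x < d") (auto simp: f'_def W_def)
    show "f' x + g x \<le> 0" if "x \<notin> U" for x
      using belowD(4)[OF f'(1), of x] belowD(4)[OF g(1), of x] that by (simp add: W_def)
  qed
  have "open_mass (U \<inter> V) + outer_mass (U - V) \<le> (ennreal (L f) + ennreal d) + (ennreal (L g) + ennreal d)"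
    using f(2) g(2) \<open>outer_mass (U - V) \<le> open_mass W\<close> by (intro add_mono) auto
  also have "\<dots> = ennreal (L f + d + (L g + d))"
    using \<open>0 < d\<close> belowD(5)[OF f(1)] belowD(5)[OF g(1)] by (simp del: ennreal_plus add: ennreal_plus[symmetric])
  also have "\<dots> \<le> ennreal (L (\<lambda>x. f' x + g x) + d * (L (\<lambda>x. 1) + 2))"
    using f'(2) by (intro ennreal_leI) (simp add: add belowD(1)[OF f'(1)] belowD(1)[OF g(1)] algebra_simps)
  also have "\<dots> = ennreal (L (\<lambda>x. f' x + g x)) + ennreal (d * (L (\<lambda>x. 1) + 2))"
    using \<open>0 < d\<close> belowD(5)[OF sum_below] one_nonneg by (simp add: ennreal_plus)
  also have "\<dots> \<le> open_mass U + ennreal (d * (L (\<lambda>x. 1) + 2))"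
    by (intro add_right_mono open_mass_upper sum_below)
  finally show "open_mass (U \<inter> V) + outer_mass (U - V) \<le> open_mass U + ennreal (d * (L (\<lambda>x. 1) + 2))" .
qed

lemma outer_mass_mono: "E \<subseteq> F \<Longrightarrow> outer_mass E \<le> outer_mass F"
  unfolding outer_mass_def by (intro INF_superset_mono) auto

lemma outer_mass_open: "open U \<Longrightarrow> outer_mass U = open_mass U"
  unfolding outer_mass_def by (intro antisym INF_lower INF_greatest open_mass_mono) auto

lemma outer_mass_finite: "outer_mass E < \<infinity>"
  using outer_mass_mono[of E UNIV] by (simp add: outer_mass_open open_mass_UNIV le_less_trans)

lemma outer_mass_approx:
  assumes "0 < d"
  obtains U where "open U" "E \<subseteq> U" "open_mass U \<le> outer_mass E + ennreal d"
proof -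
  have "outer_mass E < outer_mass E + ennreal d"
    using outer_mass_finite[of E] assms by (simp add: ennreal_less_top less_top add_strict_increasing2)
  then show ?thesis
    using that unfolding outer_mass_def INF_less_iff by (auto dest: less_imp_le)
qed

lemma outer_mass_UN:
  fixes E :: "nat \<Rightarrow> 'a set"
  shows "outer_mass (\<Union>i. E i) \<le> (\<Sum>i. outer_mass (E i))"
proof (rule ennreal_le_epsilon)
  fix e :: real assume "0 < e"
  have "\<exists>U. open U \<and> E i \<subseteq> U \<and> open_mass U \<le> outer_mass (E i) + ennreal (e * (1/2) ^ Suc i)" for i
    using \<open>0 < e\<close> by (rule_tac outer_mass_approx[of "e * (1/2) ^ Suc i" "E i"]) auto
  then obtain U where U: "\<And>i. open (U i)" "\<And>i. E i \<subseteq> U i"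
      "\<And>i. open_mass (U i) \<le> outer_mass (E i) + ennreal (e * (1/2) ^ Suc i)"
    by metis
  have "outer_mass (\<Union>i. E i) \<le> open_mass (\<Union>i. U i)"
    unfolding outer_mass_def using U by (intro INF_lower) auto
  also have "\<dots> \<le> (\<Sum>i. open_mass (U i))"
    by (rule open_mass_UN[OF U(1)])
  also have "\<dots> \<le> (\<Sum>i. outer_mass (E i) + ennreal (e * (1/2) ^ Suc i))"
    using U(3) by (intro suminf_le) auto
  also have "\<dots> = (\<Sum>i. outer_mass (E i)) + (\<Sum>i. ennreal (e * (1/2) ^ Suc i))"
    by (intro suminf_add[symmetric]) auto
  also have "(\<Sum>i. ennreal (e * (1/2) ^ Suc i)) = ennreal (e * 1)"
    using \<open>0 < e\<close> by (intro suminf_ennreal_eq sums_mult power_half_series) auto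
  finally show "outer_mass (\<Union>i. E i) \<le> (\<Sum>i. outer_mass (E i)) + ennreal e" by simp
qed

section \<open>Caratheodory measurability of open sets\<close>

lemma outer_measure_space_outer_mass: "outer_measure_space UNIV outer_mass"
proof -
  have "outer_mass {} = 0"
  proof -
    have "open_mass {} \<le> 0"
      proof (rule open_mass_least)
      fix f assume f: "f \<in> below {}"
      have "L f = L (\<lambda>x. 0)"
        using belowD(4)[OF f] by (intro cong belowD(1)[OF f]) auto
      then show "ennreal (L f) \<le> 0" by (simp add: zero)
    qed
    then show ?thesis by (simp add: outer_mass_open)
  qed
  then show ?thesis
    using outer_mass_mono outer_mass_UN
    by (auto simp: outer_measure_space_def positive_def increasing_def countably_subadditive_def)
qed

text \<open>Any \<open>E\<close> lies in an open set of almost the same outer mass, to which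
  \<open>open_mass_split\<close> applies; the other inequality is subadditivity.\<close>

lemma outer_mass_split:
  assumes V: "open V"
  shows "outer_mass (E \<inter> V) + outer_mass (E - V) = outer_mass E"
proof (rule antisym)
  show "outer_mass (E \<inter> V) + outer_mass (E - V) \<le> outer_mass E"
  proof (rule ennreal_le_epsilon)
    fix e :: real assume "0 < e"
    obtain U where U: "open U" "E \<subseteq> U" "open_mass U \<le> outer_mass E + ennreal e"
      by (rule outer_mass_approx[OF \<open>0 < e\<close>])
    have "outer_mass (E \<inter> V) + outer_mass (E - V) \<le> outer_mass (U \<inter> V) + outer_mass (U - V)"
      using U(2) by (intro add_mono outer_mass_mono) auto
    also have "\<dots> \<le> open_mass U"
      using open_mass_split[OF U(1) V] U(1) V by (simp add: outer_mass_open open_Int)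
    finally show "outer_mass (E \<inter> V) + outer_mass (E - V) \<le> outer_mass E + ennreal e"
      using U(3) by (rule order_trans)
  qed
  \<comment> \<open>The second \<open>UNIV\<close> is the power set; on it countable subadditivity
    of \<open>outer_mass\<close> yields finite subadditivity.\<close>
  interpret sigma_algebra UNIV UNIV
    using sigma_algebra_Pow[of UNIV] by simp
  have "subadditive UNIV outer_mass"
    using outer_measure_space_outer_mass countably_subadditive_subadditive by (auto simp: outer_measure_space_def)
  then have "outer_mass ((E \<inter> V) \<union> (E - V)) \<le> outer_mass (E \<inter> V) + outer_mass (E - V)"
    by (rule subadditiveD) auto
  then show "outer_mass E \<le> outer_mass (E \<inter> V) + outer_mass (E - V)"
    by (simp add: Int_Diff_Un)
qed

section \<open>The Riesz measure and its regularity\<close>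

text \<open>\<open>measure_of\<close> would yield the zero measure if \<open>outer_mass\<close> were
  not countably additive on Borel sets; \<open>emeasure_riesz_measure\<close> rules this
  out.\<close>

definition riesz_measure :: "'a measure"
  where "riesz_measure = measure_of UNIV (sets borel) outer_mass"

lemma sets_riesz_measure [measurable_cong, simp]: "sets riesz_measure = sets borel"
  and space_riesz_measure [simp]: "space riesz_measure = UNIV"
  using sets.sigma_sets_eq[of "borel :: 'a measure"] by (auto simp: riesz_measure_def)

text \<open>The Caratheodory measurable sets form a sigma-algebra that contains the open sets by
  \<open>outer_mass_split\<close>, hence all Borel sets.\<close>

lemma emeasure_riesz_measure:
  assumes "B \<in> sets borel"
  shows "emeasure riesz_measure B = outer_mass B"
proof -
  interpret P: sigma_algebra UNIV "UNIV :: 'a set set"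
    using sigma_algebra_Pow[of UNIV] by simp
  let ?A = "lambda_system UNIV UNIV outer_mass"
  have ms: "measure_space UNIV ?A outer_mass"
    by (rule P.caratheodory_lemma[OF outer_measure_space_outer_mass])
  then interpret A: sigma_algebra UNIV ?A
    by (simp add: measure_space_def)
  have "{U. open U} \<subseteq> ?A"
    by (auto simp: P.lambda_system_eq outer_mass_split)
  then have "sets borel \<subseteq> ?A"
    unfolding borel_def by (simp add: A.sigma_sets_subset)
  moreover have "sigma_algebra UNIV (sets (borel :: 'a measure))"
    using sets.sigma_algebra_axioms[of "borel :: 'a measure"] by simp
  ultimately have "measure_space UNIV (sets borel) outer_mass"
    using measure_down[OF ms] by blast
  then show ?thesis
    using assms by (intro emeasure_measure_of[OF riesz_measure_def]) (auto simp: measure_space_def)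
qed

text \<open>A function below \<open>- K\<close> agrees with 0 on \<open>K\<close>, so
  \<open>L\<close> sends it to 0.\<close>

lemma null_compl: "emeasure riesz_measure (- K) = 0"
proof -
  have K: "open (- K)"
    using compact_imp_closed[OF compact] by blast
  have "open_mass (- K) \<le> 0"
  proof (rule open_mass_least)
    fix f assume f: "f \<in> below (- K)"
    have "L f = L (\<lambda>x. 0)"
      using belowD(4)[OF f] by (intro cong belowD(1)[OF f]) auto
    then show "ennreal (L f) \<le> 0" by (simp add: zero)
  qed
  then show ?thesis
    using K by (simp add: emeasure_riesz_measure outer_mass_open)
qed

lemma finite_measure_riesz_measure: "finite_measure riesz_measure"
  using outer_mass_finite[of UNIV] by (intro finite_measureI) (simp add: emeasure_riesz_measure)

lemma compact_support_riesz_measure: "Topological_Spaces.compact (measure_support riesz_measure)"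
proof -
  have "open (- K)"
    using compact_imp_closed[OF compact] by blast
  then have "measure_support riesz_measure = K \<inter> measure_support riesz_measure"
    using null_compl by (auto simp: measure_support_def)
  also have "Topological_Spaces.compact \<dots>"
    by (intro compact_Int_closed compact) (auto simp: measure_support_def)
  finally show ?thesis .
qed

text \<open>Inner regularity is outer regularity of the complement: an open \<open>U\<close> around
  \<open>- B\<close> with small excess leaves the compact subset \<open>K - U\<close> of
  \<open>B\<close>, and only the excess and the null set \<open>- K\<close> are lost.\<close>

lemma radon_measure_riesz_measure: "radon_measure riesz_measure"
proof -
  interpret finite_measure riesz_measure
    by (rule finite_measure_riesz_measure)
  have "emeasure riesz_measure B = (SUP C\<in>{C. Topological_Spaces.compact C \<and> C \<subseteq> B}. emeasure riesz_measure C)"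
    (is "_ = ?sup") if B: "B \<in> sets borel" for B
  proof (rule antisym)
    show "?sup \<le> emeasure riesz_measure B"
      using B by (intro SUP_least emeasure_mono) auto
    show "emeasure riesz_measure B \<le> ?sup"
    proof (rule ennreal_le_epsilon)
      fix e :: real assume "0 < e"
      obtain U where U: "open U" "- B \<subseteq> U" "open_mass U \<le> outer_mass (- B) + ennreal e"
        by (rule outer_mass_approx[OF \<open>0 < e\<close>])
      have [measurable]: "U \<in> sets borel" "K \<in> sets borel"
        using U(1) compact_imp_closed[OF compact] by auto
      define C where "C = K \<inter> - U"
      have C: "Topological_Spaces.compact C" "C \<subseteq> B"
        using U compact by (auto simp: C_def intro!: compact_Int_closed)
      then have [measurable]: "C \<in> sets borel"
        by (auto intro: borel_closed compact_imp_closed)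
      \<comment> \<open>\<open>U \<inter> B\<close> is the excess of \<open>U\<close> over
        \<open>- B\<close>; finiteness of the measure permits the cancellation that bounds
        it.\<close>
      have "emeasure riesz_measure (- B) + emeasure riesz_measure (U \<inter> B) = emeasure riesz_measure U"
        using U(2) B by (subst plus_emeasure) (auto intro!: arg_cong[where f = "emeasure _"])
      also have "\<dots> \<le> emeasure riesz_measure (- B) + ennreal e"
        using U B by (simp add: emeasure_riesz_measure outer_mass_open)
      finally have *: "emeasure riesz_measure (U \<inter> B) \<le> ennreal e"
        by (simp add: ennreal_add_left_cancel_le)
      have "emeasure riesz_measure B \<le> emeasure riesz_measure (C \<union> (U \<inter> B) \<union> - K)"
        using B by (intro emeasure_mono) (auto simp: C_def)
      also have "\<dots> \<le> emeasure riesz_measure C + emeasure riesz_measure (U \<inter> B) + emeasure riesz_measure (- K)"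
        using B by (intro order_trans[OF emeasure_subadditive] add_right_mono emeasure_subadditive) auto
      also have "\<dots> \<le> ?sup + ennreal e + 0"
        using C * by (intro add_mono SUP_upper) (auto simp: null_compl)
      finally show "emeasure riesz_measure B \<le> ?sup + ennreal e" by simp
    qed
  qed
  then show ?thesis
    by (auto simp: radon_measure_def top.not_eq_extremum[symmetric])
qed

section \<open>Integral representation\<close>

lemma measurable_riesz: "continuous_on UNIV f \<Longrightarrow> f \<in> borel_measurable riesz_measure"
  for f :: "'a \<Rightarrow> real"
  using borel_measurable_continuous_onI[of f] measurable_cong_sets[OF sets_riesz_measure refl] by blast

lemma integrable_bounded:
  fixes f :: "'a \<Rightarrow> real"
  assumes "continuous_on UNIV f" "\<And>x. 0 \<le> f x" "\<And>x. f x \<le> 1"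
  shows "integrable riesz_measure f"
proof -
  interpret finite_measure riesz_measure
    by (rule finite_measure_riesz_measure)
  show ?thesis
    using assms by (intro integrable_const_bound[where B = 1] measurable_riesz) auto
qed

text \<open>Cutting \<open>n f\<close> into slices of height 1, each slice has functional at most the measure of the
  set where it is positive, and there the slice below it equals 1.\<close>

lemma le_integral:
  assumes f: "continuous_on UNIV f" "\<And>x. 0 \<le> f x" "\<And>x. f x \<le> 1"
  shows "L f \<le> (\<integral>x. f x \<partial>riesz_measure)"
proof (rule field_le_epsilon)
  interpret finite_measure riesz_measure
    by (rule finite_measure_riesz_measure)
  let ?\<mu> = "measure riesz_measure"
  fix e :: real assume "0 < e"
  \<comment> \<open>The comparison for \<open>n\<close> times \<open>f\<close> loses at most the
    total mass, so after division by this \<open>n\<close> the loss is below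
    \<open>e\<close>.\<close>
  obtain n :: nat where n: "?\<mu> UNIV / e < real n"
    using reals_Archimedean2 by blast
  then have "0 < n"
    using \<open>0 < e\<close> by (intro gr0I) (auto simp: divide_less_0_iff measure_nonneg leD)
  define s where "s k x = min 1 (max 0 (real n * f x - real k))" for k x
  define V where "V k = {x. real k < real n * f x}" for k :: nat
  have cont: "continuous_on UNIV (s k)" for k
    unfolding s_def by (intro continuous_intros f)
  have V: "open (V k)" for k
    unfolding V_def by (intro open_Collect_less continuous_intros f)
  have int: "integrable riesz_measure (s k)" for k
    using cont by (rule integrable_bounded) (auto simp: s_def)
  \<comment> \<open>Since \<open>f \<le> 1\<close>, the first \<open>n\<close> slices exhaust
    \<open>n\<close> times \<open>f\<close>.\<close>
  have slices: "(\<Sum>k<n. s k x) = real n * f x" for x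
    using f sum_slices[of "real n * f x" n] \<open>0 < n\<close> by (simp add: s_def min_def mult_left_le)
  have upper: "L (s k) \<le> ?\<mu> (V k)" for k
  proof -
    have "s k \<in> below (V k)"
      using cont by (rule belowI) (auto simp: s_def V_def)
    then have "ennreal (L (s k)) \<le> emeasure riesz_measure (V k)"
      using V[of k] by (simp add: emeasure_riesz_measure outer_mass_open open_mass_upper)
    then show ?thesis
      by (simp add: emeasure_eq_measure)
  qed
  have lower: "?\<mu> (V (Suc k)) \<le> (\<integral>x. s k x \<partial>riesz_measure)" for k
  proof -
    have "?\<mu> (V (Suc k)) = (\<integral>x. indicator (V (Suc k)) x \<partial>riesz_measure)"
      by simp
    also have "\<dots> \<le> (\<integral>x. s k x \<partial>riesz_measure)"
      using V[of "Suc k"]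
      by (intro integral_mono int integrable_real_indicator)
         (auto simp: s_def V_def indicator_def less_top[symmetric])
    finally show ?thesis .
  qed
  have "real n * L f = L (\<lambda>x. \<Sum>k<n. s k x)"
    using f by (simp add: slices scale)
  also have "\<dots> = (\<Sum>k<n. L (s k))"
    by (rule sum) (rule cont)
  also have "\<dots> \<le> (\<Sum>k<n. ?\<mu> (V k))"
    by (intro sum_mono upper)
  \<comment> \<open>The extra summand \<open>V n\<close> allows an index shift: each
    \<open>V (Suc k)\<close> is then compared with slice \<open>k\<close>, and only
    \<open>V 0\<close> is left over.\<close>
  also have "\<dots> \<le> (\<Sum>k<Suc n. ?\<mu> (V k))"
    by simp
  also have "\<dots> = ?\<mu> (V 0) + (\<Sum>k<n. ?\<mu> (V (Suc k)))"
    by (rule sum.lessThan_Suc_shift)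
  also have "\<dots> \<le> ?\<mu> UNIV + (\<Sum>k<n. \<integral>x. s k x \<partial>riesz_measure)"
    using bounded_measure[of "V 0"] by (intro add_mono sum_mono lower) simp
  also have "(\<Sum>k<n. \<integral>x. s k x \<partial>riesz_measure) = (\<integral>x. (\<Sum>k<n. s k x) \<partial>riesz_measure)"
    by (rule Bochner_Integration.integral_sum[symmetric]) (rule int)
  also have "\<dots> = real n * (\<integral>x. f x \<partial>riesz_measure)"
    by (simp add: slices)
  finally have "real n * (L f - (\<integral>x. f x \<partial>riesz_measure)) \<le> ?\<mu> UNIV"
    by (simp add: algebra_simps)
  also have "\<dots> < real n * e"
    using n \<open>0 < e\<close> by (simp add: field_simps)
  finally have "L f - (\<integral>x. f x \<partial>riesz_measure) < e"
    using \<open>0 < n\<close> by simp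
  then show "L f \<le> (\<integral>x. f x \<partial>riesz_measure) + e"
    by simp
qed

text \<open>The inequality for \<open>1 - f\<close> reverses the one for \<open>f\<close>, because
  the total mass equals \<open>L (\<lambda>x. 1)\<close>.\<close>

lemma eq_integral_unit:
  assumes f: "continuous_on UNIV f" "\<And>x. 0 \<le> f x" "\<And>x. f x \<le> 1"
  shows "L f = (\<integral>x. f x \<partial>riesz_measure)"
proof (rule antisym)
  interpret finite_measure riesz_measure
    by (rule finite_measure_riesz_measure)
  show "L f \<le> (\<integral>x. f x \<partial>riesz_measure)"
    by (rule le_integral[OF f])
  have "L (\<lambda>x. 1 - f x) \<le> (\<integral>x. 1 - f x \<partial>riesz_measure)"
    using f by (intro le_integral continuous_intros) auto
  moreover have "emeasure riesz_measure UNIV = ennreal (L (\<lambda>x. 1))"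
    by (simp add: emeasure_riesz_measure outer_mass_open open_mass_UNIV)
  then have "measure riesz_measure UNIV = L (\<lambda>x. 1)"
    using one_nonneg by (simp add: measure_def)
  ultimately show "(\<integral>x. f x \<partial>riesz_measure) \<le> L f"
    using f by (simp add: diff integrable_bounded)
qed

text \<open>On \<open>K\<close> the function is an affine image of some \<open>g\<close> with values
  in \<open>[0, 1]\<close>. Off \<open>K\<close>, where \<open>f\<close> may be unbounded, neither
  \<open>L\<close> nor the measure sees the difference.\<close>

lemma riesz_representation:
  assumes f: "continuous_on UNIV f"
  shows "integrable riesz_measure f \<and> L f = (\<integral>x. f x \<partial>riesz_measure)"
proof -
  interpret finite_measure riesz_measure
    by (rule finite_measure_riesz_measure)
  have "bounded (f ` K)"
    using f by (intro compact_imp_bounded compact_continuous_image compact continuous_on_subset[OF f]) simp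
  then obtain c where "0 < c" and c: "\<And>x. x \<in> K \<Longrightarrow> \<bar>f x\<bar> \<le> c"
    by (auto simp: bounded_pos)
  define g where "g x = max 0 (min 1 ((f x + c) / (2 * c)))" for x
  have g: "continuous_on UNIV g" "\<And>x. 0 \<le> g x" "\<And>x. g x \<le> 1"
    unfolding g_def by (intro continuous_intros f) (use \<open>0 < c\<close> in auto)
  have cont: "continuous_on UNIV (\<lambda>x. 2 * c * g x)"
    by (intro continuous_intros g)
  have fg: "f x = 2 * c * g x - c" if "x \<in> K" for x
  proof -
    have "0 \<le> (f x + c) / (2 * c)" "(f x + c) / (2 * c) \<le> 1"
      using c[OF that] \<open>0 < c\<close> by (auto simp: field_simps abs_le_iff)
    then show ?thesis
      using \<open>0 < c\<close> by (simp add: g_def)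
  qed
  have "AE x in riesz_measure. x \<in> K"
    using null_compl compact_imp_closed[OF compact] by (intro AE_I[of _ _ "- K"]) auto
  then have ae: "AE x in riesz_measure. 2 * c * g x - c = f x"
    by eventually_elim (simp add: fg)
  have int: "integrable riesz_measure g"
    by (rule integrable_bounded[OF g])
  then have "integrable riesz_measure (\<lambda>x. 2 * c * g x - c)"
    by simp
  then have "integrable riesz_measure f"
    using integrable_cong_AE_imp[OF _ measurable_riesz[OF f]] ae by blast
  moreover have "L f = 2 * c * L g - c * L (\<lambda>x. 1)"
    using cong[OF f _ fg] cont g by (simp add: continuous_on_diff diff scale const[of c])
  moreover have "(\<integral>x. f x \<partial>riesz_measure) = (\<integral>x. 2 * c * g x - c \<partial>riesz_measure)"
    using ae f cont by (intro integral_cong_AE measurable_riesz) (auto intro: continuous_on_diff)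
  moreover have "(\<integral>x. 2 * c * g x - c \<partial>riesz_measure) = 2 * c * (\<integral>x. g x \<partial>riesz_measure) - c * (\<integral>x. 1 \<partial>riesz_measure)"
    using int by simp
  ultimately show ?thesis
    using eq_integral_unit[OF g] eq_integral_unit[of "\<lambda>x. 1"] by simp
qed

end

section \<open>Bump functions and compact exhaustions\<close>

lemma Hausdorff_space_t2: "Hausdorff_space (euclidean :: 'a::t2_space topology)"
  unfolding Hausdorff_space_def
  using hausdorff by (fastforce simp: disjnt_def)

text \<open>Locally compact Hausdorff spaces are completely regular. The function this provides is 0
  at \<open>x\<close> and 1 off \<open>U\<close>, so it is reflected to
  \<open>1 - f\<close>.\<close>

lemma locally_compact_bump:
  assumes lc: "locally_compact_space (euclidean :: 'a::t2_space topology)"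
    and U: "open (U :: 'a::t2_space set)" "x \<in> U"
  shows "\<exists>f. continuous_on UNIV f \<and> (\<forall>y. 0 \<le> f y \<and> f y \<le> (1 :: real)) \<and> (\<forall>y. y \<notin> U \<longrightarrow> f y = 0) \<and> f x = 1"
proof -
  have "completely_regular_space (euclidean :: 'a topology)"
    using locally_compact_regular_imp_completely_regular_space[OF lc] Hausdorff_space_t2 by blast
  moreover have "closedin euclidean (- U)"
    using U(1) by (simp add: closed_Compl)
  ultimately obtain f :: "'a \<Rightarrow> real" where f: "continuous_map euclidean (top_of_set {0..1}) f"
      "f x = 0" "f ` (- U) \<subseteq> {1}"
    using U(2) unfolding completely_regular_space_def by force
  have "continuous_on UNIV f" "\<And>y. f y \<in> {0..1}"
    using f(1) by (auto simp: continuous_map_in_subtopology)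
  then show ?thesis
    using f(2,3) by (intro exI[of _ "\<lambda>y. 1 - f y"]) (auto intro!: continuous_intros)
qed

text \<open>Every compact set has a compact neighbourhood; the recursion takes one of
  \<open>C n \<union> K (Suc n)\<close>. The nested interiors later make locally finite sums
  continuous.\<close>

lemma compact_exhaustion:
  assumes sc: "sigma_compact (UNIV :: 'a::t2_space set)"
    and lc: "locally_compact_space (euclidean :: 'a::t2_space topology)"
  obtains C :: "nat \<Rightarrow> 'a::t2_space set"
  where "\<And>n. compact (C n)" "\<And>n. C n \<subseteq> interior (C (Suc n))" "(\<Union>n. C n) = UNIV"
proof -
  obtain K :: "nat \<Rightarrow> 'a set" where K: "\<And>n. compact (K n)" "(\<Union>n. K n) = UNIV"
    using sc unfolding sigma_compact_def by blast
  have "\<exists>C. compact C \<and> D \<subseteq> interior C" if "compact D" for D :: "'a set"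
  proof -
    have "compactin euclidean D"
      using that by simp
    then obtain U L where UL: "openin euclidean U" "compactin euclidean L" "D \<subseteq> U" "U \<subseteq> L"
      using lc unfolding locally_compact_space_compact_closed_compact[OF disjI1[OF Hausdorff_space_t2]]
      by blast
    then show ?thesis
      by (metis compactin_euclidean_iff interior_maximal open_openin subset_trans)
  qed
  then obtain E :: "'a set \<Rightarrow> 'a set" where E: "\<And>D. compact D \<Longrightarrow> compact (E D)" "\<And>D. compact D \<Longrightarrow> D \<subseteq> interior (E D)"
    by metis
  define C where "C = rec_nat (K 0) (\<lambda>n D. E (D \<union> K (Suc n)))"
  have C_simps: "C 0 = K 0" "C (Suc n) = E (C n \<union> K (Suc n))" for n
    by (simp_all add: C_def)
  have C: "compact (C n)" for n
    by (induction n) (auto simp: C_simps intro!: K E(1) compact_Un)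
  have step: "C n \<union> K (Suc n) \<subseteq> interior (C (Suc n))" for n
    unfolding C_simps using C K by (intro E compact_Un)
  have "K n \<subseteq> C n" for n
    using step interior_subset by (cases n) (auto simp: C_simps, blast)
  then have "(\<Union>n. K n) \<subseteq> (\<Union>n. C n)"
    by (intro UN_mono) auto
  then have "(\<Union>n. C n) = UNIV"
    using K(2) by auto
  with C step show ?thesis
    by (intro that) auto
qed

section \<open>Concentration of positive functionals on a compact set\<close>

text \<open>Otherwise there are nonnegative functions \<open>g n\<close> vanishing on \<open>C n\<close> with value 1 under
  the functional; their locally finite sum would have an infinite value.\<close>

lemma positive_functional_concentrated:
  fixes L :: "('a::t2_space \<Rightarrow> real) \<Rightarrow> real"
  assumes C: "\<And>n. C n \<subseteq> interior (C (Suc n))" "(\<Union>n. C n) = UNIV"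
    and lin: "linear_functional_on continuous_functions L"
    and pos: "positive_on continuous_functions L"
  obtains n where "\<And>f. continuous_on UNIV f \<Longrightarrow> (\<And>x. x \<in> C n \<Longrightarrow> 0 \<le> f x) \<Longrightarrow> 0 \<le> L f"
proof -
  have add: "L (\<lambda>x. f x + g x) = L f + L g" if "continuous_on UNIV f" "continuous_on UNIV g" for f g
    using lin that by (auto simp: linear_functional_on_def continuous_functions_def)
  have scale: "L (\<lambda>x. c * f x) = c * L f" if "continuous_on UNIV f" for f c
    using lin that by (auto simp: linear_functional_on_def continuous_functions_def)
  have nonneg: "0 \<le> L f" if "continuous_on UNIV f" "\<And>x. 0 \<le> f x" for f
    using pos that by (auto simp: positive_on_def continuous_functions_def)
  \<comment> \<open>It suffices that \<open>L\<close> vanishes on these functions: the negative part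
    of a function that is nonnegative on \<open>C n\<close> is one of them.\<close>
  have "\<exists>n. \<forall>f. continuous_on UNIV f \<and> (\<forall>x. 0 \<le> f x) \<and> (\<forall>x\<in>C n. f x = 0) \<longrightarrow> L f = 0"
  proof (rule ccontr)
    assume "\<not> ?thesis"
    then obtain f where f: "\<And>n. continuous_on UNIV (f n)" "\<And>n x. 0 \<le> f n x"
        "\<And>n x. x \<in> C n \<Longrightarrow> f n x = 0" "\<And>n. L (f n) \<noteq> 0"
      by metis
    have Lf: "0 < L (f n)" for n
      using nonneg[OF f(1,2), of n] f(4)[of n] by simp
    define g where "g n x = inverse (L (f n)) * f n x" for n x
    have g: "continuous_on UNIV (g n)" "0 \<le> g n x" for n x
      using f(1,2) Lf[of n] by (auto simp: g_def intro!: continuous_intros)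
    have Lg: "L (g n) = 1" for n
      unfolding g_def using f(1) Lf[of n] by (simp add: scale)
    have "C n \<subseteq> C (Suc n)" for n
      using C(1)[of n] interior_subset by (rule subset_trans)
    then have "C m \<subseteq> C n" if "m \<le> n" for m n
      using that by (rule lift_Suc_mono_le)
    then have g0: "g n x = 0" if "x \<in> C m" "m \<le> n" for n m x
      using that f(3)[of x n] by (auto simp: g_def)
    have fin: "(\<lambda>n. g n x) sums (\<Sum>n<m. g n x)" if "x \<in> C m" for m x
      using g0[OF that] by (intro sums_finite) auto
    define F where "F x = (\<Sum>n. g n x)" for x
    have F: "F x = (\<Sum>n<m. g n x)" if "x \<in> C m" for m x
      using fin[OF that] by (simp add: F_def sums_iff)
    \<comment> \<open>On \<open>C m\<close> the sum is finite, so \<open>F\<close> is continuous on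
      each interior, and the interiors cover the space.\<close>
    have "continuous_on (\<Union>m. interior (C m)) F"
    proof (rule continuous_on_open_UN)
      fix m
      have "continuous_on (interior (C m)) (\<lambda>x. \<Sum>n<m. g n x)"
        using g(1) by (intro continuous_on_sum) (auto intro: continuous_on_subset)
      then show "continuous_on (interior (C m)) F"
        by (rule continuous_on_eq) (metis F interior_subset subsetD)
    qed simp
    moreover have "x \<in> (\<Union>m. interior (C m))" for x
    proof -
      obtain m where "x \<in> C m" using C(2) by blast
      then show ?thesis using C(1)[of m] by blast
    qed
    then have "(\<Union>m. interior (C m)) = UNIV" by blast
    ultimately have cF: "continuous_on UNIV F"
      by simp
    have cS: "continuous_on UNIV (\<lambda>x. \<Sum>n<N. g n x)" for N :: nat
      by (intro continuous_on_sum g)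
    have L0: "L (\<lambda>x. 0) = 0"
      using scale[of "\<lambda>x. 0" 0] by simp
    have LS: "L (\<lambda>x. \<Sum>n<N. g n x) = real N" for N :: nat
    proof (induction N)
      case (Suc N)
      then show ?case
        using add[OF cS[of N] g(1)[of N]] by (simp add: Lg)
    qed (simp add: L0)
    \<comment> \<open>Only finite partial sums are compared with \<open>F\<close>: positivity of the
      remainder bounds \<open>L F\<close> below by each of their values.\<close>
    have "real N \<le> L F" for N :: nat
    proof -
      have "0 \<le> L (\<lambda>x. F x + -1 * (\<Sum>n<N. g n x))"
      proof (rule nonneg)
        show "continuous_on UNIV (\<lambda>x. F x + - 1 * (\<Sum>n<N. g n x))"
          by (intro continuous_on_add continuous_on_mult cF cS continuous_on_const)
        fix x
        obtain m where "x \<in> C m" using C(2) by blast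
        then have "summable (\<lambda>n. g n x)"
          using fin by (auto simp: sums_iff)
        then show "0 \<le> F x + - 1 * (\<Sum>n<N. g n x)"
          using g(2) by (auto simp: F_def intro!: sum_le_suminf)
      qed
      also have "\<dots> = L F + -1 * L (\<lambda>x. \<Sum>n<N. g n x)"
        by (simp only: add cF cS continuous_on_mult continuous_on_const scale)
      finally show ?thesis
        by (simp add: LS)
    qed
    then show False
      using reals_Archimedean2[of "L F"] by (meson not_le)
  qed
  then obtain n where n: "\<And>f. continuous_on UNIV f \<Longrightarrow> (\<And>x. 0 \<le> f x) \<Longrightarrow> (\<And>x. x \<in> C n \<Longrightarrow> f x = 0) \<Longrightarrow> L f = 0"
    by blast
  show ?thesis
  proof (rule that)
    fix f :: "'a \<Rightarrow> real"
    assume f: "continuous_on UNIV f" "\<And>x. x \<in> C n \<Longrightarrow> 0 \<le> f x"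
    have c: "continuous_on UNIV (\<lambda>x. max 0 (f x))" "continuous_on UNIV (\<lambda>x. max 0 (- f x))"
      by (intro continuous_intros f)+
    have "f = (\<lambda>x. max 0 (f x) + -1 * max 0 (- f x))"
      by auto
    then have "L f = L (\<lambda>x. max 0 (f x) + -1 * max 0 (- f x))"
      by simp
    also have "\<dots> = L (\<lambda>x. max 0 (f x)) + -1 * L (\<lambda>x. max 0 (- f x))"
      by (simp only: add c continuous_on_mult continuous_on_const scale)
    also have "L (\<lambda>x. max 0 (- f x)) = 0"
      using c f by (intro n) auto
    finally show "0 \<le> L f"
      using nonneg[OF c(1)] by simp
  qed
qed

section \<open>Point-separating sigma-complete subalgebras\<close>

locale sigma_complete_subalgebra =
  fixes A :: "('a::t2_space \<Rightarrow> real) set"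
  assumes sigma_compact: "sigma_compact (UNIV :: 'a set)"
    and subalgebra: "subalgebra_of_C A"
    and complete: "sigma_complete A"
    and separates: "separates_points A"
begin

lemma mem_continuous: "f \<in> A \<Longrightarrow> continuous_on UNIV f"
  and mem_zero: "(\<lambda>x. 0) \<in> A"
  and mem_add: "f \<in> A \<Longrightarrow> g \<in> A \<Longrightarrow> (\<lambda>x. f x + g x) \<in> A"
  and mem_scale: "f \<in> A \<Longrightarrow> (\<lambda>x. c * f x) \<in> A"
  and mem_mult: "f \<in> A \<Longrightarrow> g \<in> A \<Longrightarrow> (\<lambda>x. f x * g x) \<in> A"
  using subalgebra by (auto simp: subalgebra_of_C_def continuous_functions_def)

lemma mem_diff: "f \<in> A \<Longrightarrow> g \<in> A \<Longrightarrow> (\<lambda>x. f x - g x) \<in> A"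
  using mem_add[of f "\<lambda>x. -1 * g x"] mem_scale[of g "-1"] by simp

lemma mem_sum: "(\<And>i. i \<in> I \<Longrightarrow> f i \<in> A) \<Longrightarrow> (\<lambda>x. \<Sum>i\<in>I. f i x) \<in> A"
  by (induction I rule: infinite_finite_induct) (auto simp: mem_zero mem_add)

text \<open>Differences of consecutive terms, preceded by \<open>b 0\<close>, turn the sequence into
  a series, so sigma-completeness covers continuous pointwise limits.\<close>

lemma mem_limit:
  assumes b: "\<And>n. b n \<in> A" and s: "continuous_on UNIV s" "\<And>x. (\<lambda>n. b n x) \<longlonglongrightarrow> s x"
  shows "s \<in> A"
proof -
  define c where "c n = (case n of 0 \<Rightarrow> b 0 | Suc m \<Rightarrow> (\<lambda>x. b (Suc m) x - b m x))" for n
  have "c n \<in> A" for n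
    by (cases n) (auto simp: c_def b mem_diff)
  moreover have "(\<lambda>n. c n x) sums s x" for x
    using sums_Suc[of "\<lambda>n. c n x" "s x - b 0 x"] telescope_sums[OF s(2)[of x]] by (simp add: c_def)
  ultimately show ?thesis
    using complete s(1) unfolding sigma_complete_def continuous_functions_def by blast
qed

text \<open>Finite partial unions make membership of a point eventual, so bounds on each
  \<open>C n\<close> translate into pointwise limits.\<close>

lemma compact_chain:
  obtains C :: "nat \<Rightarrow> 'a set"
  where "\<And>n. compact (C n)" "\<And>x. \<forall>\<^sub>F n in sequentially. x \<in> C n"
proof -
  obtain K :: "nat \<Rightarrow> 'a set" where K: "\<And>n. compact (K n)" "(\<Union>n. K n) = UNIV"
    using sigma_compact unfolding sigma_compact_def by blast
  show ?thesis
  proof (rule that)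
    show "compact (\<Union>i\<le>n. K i)" for n
      using K by (intro compact_UN) auto
    fix x
    obtain m where "x \<in> K m" using K(2) by blast
    then show "\<forall>\<^sub>F n in sequentially. x \<in> (\<Union>i\<le>n. K i)"
      by (auto intro!: eventually_sequentiallyI[of m])
  qed
qed

text \<open>Constants are adjoined because \<open>A\<close> may lack them while Stone-Weierstrass
  asks for them. An error below \<open>1 / Suc n\<close> on \<open>C n\<close> suffices, as each
  point lies in almost all \<open>C n\<close>.\<close>

lemma approximation:
  assumes f: "continuous_on UNIV f"
  obtains g c where "\<And>n. g n \<in> A" "\<And>x. (\<lambda>n. g n x + c n) \<longlonglongrightarrow> f x"
proof -
  obtain C :: "nat \<Rightarrow> 'a set" where C: "\<And>n. compact (C n)" "\<And>x. \<forall>\<^sub>F n in sequentially. x \<in> C n"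
    by (rule compact_chain) blast
  define R where "R = {\<lambda>x. g x + c | g c. g \<in> A}"
  have "\<exists>g c. g \<in> A \<and> (\<forall>x\<in>C n. \<bar>f x - (g x + c)\<bar> < 1 / Suc n)" for n
  proof -
    interpret function_ring_on R "C n"
    proof
      show "continuous_on (C n) f" if "f \<in> R" for f
      proof -
        have "continuous_on UNIV f"
          using that mem_continuous by (auto simp: R_def intro!: continuous_intros)
        then show ?thesis
          by (rule continuous_on_subset) simp
      qed
      show "(\<lambda>x. f x + g x) \<in> R" if fg: "f \<in> R" "g \<in> R" for f g
      proof -
        obtain f' c g' d where "f = (\<lambda>x. f' x + c)" "f' \<in> A" "g = (\<lambda>x. g' x + d)" "g' \<in> A"
          using fg by (auto simp: R_def)
        then show ?thesis
          unfolding R_def by (intro CollectI exI[of _ "\<lambda>x. f' x + g' x"] exI[of _ "c + d"]) (auto intro: mem_add)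
      qed
      show "(\<lambda>x. f x * g x) \<in> R" if fg: "f \<in> R" "g \<in> R" for f g
      proof -
        obtain f' c g' d where "f = (\<lambda>x. f' x + c)" "f' \<in> A" "g = (\<lambda>x. g' x + d)" "g' \<in> A"
          using fg by (auto simp: R_def)
        then show ?thesis
          unfolding R_def
          by (intro CollectI exI[of _ "\<lambda>x. f' x * g' x + (c * g' x + d * f' x)"] exI[of _ "c * d"])
             (auto intro!: mem_add mem_mult mem_scale simp: algebra_simps)
      qed
      show "(\<lambda>_. c) \<in> R" for c
        unfolding R_def using mem_zero by force
      show "\<exists>f\<in>R. f x \<noteq> f y" if xy: "x \<noteq> y" for x y
      proof -
        obtain h where "h \<in> A" "h x \<noteq> h y"
          using separates xy unfolding separates_points_def by blast
        moreover have "(\<lambda>x. h x + 0) \<in> R"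
          unfolding R_def using \<open>h \<in> A\<close> by blast
        ultimately show ?thesis
          by (intro bexI) simp_all
      qed
    qed (rule C)
    show ?thesis
      using Stone_Weierstrass_basic[OF continuous_on_subset[OF f subset_UNIV], of "1 / Suc n"]
      unfolding R_def by fastforce
  qed
  then obtain g c where g: "\<And>n. g n \<in> A" and gc: "\<And>n x. x \<in> C n \<Longrightarrow> \<bar>f x - (g n x + c n)\<bar> < 1 / Suc n"
    by metis
  have "(\<lambda>n. g n x + c n) \<longlonglongrightarrow> f x" for x
  proof -
    have "(\<lambda>n. (g n x + c n) - f x) \<longlonglongrightarrow> 0"
    proof (rule Lim_null_comparison)
      show "\<forall>\<^sub>F n in sequentially. norm ((g n x + c n) - f x) \<le> 1 / Suc n"
        using C(2)[of x] by eventually_elim (use gc in \<open>force simp: abs_minus_commute less_imp_le\<close>)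
      show "(\<lambda>n. 1 / real (Suc n)) \<longlonglongrightarrow> 0"
        using LIMSEQ_inverse_real_of_nat by (simp add: inverse_eq_divide)
    qed
    then show ?thesis
      by (rule LIM_zero_cancel)
  qed
  with g show ?thesis by (rule that)
qed

text \<open>Multiplication by \<open>h\<close> absorbs the constants of the approximants, since
  \<open>c n * h\<close> is in \<open>A\<close>. Thus \<open>A\<close> is an ideal of the continuous
  functions.\<close>

lemma mem_ideal:
  assumes f: "continuous_on UNIV f" and h: "h \<in> A"
  shows "(\<lambda>x. f x * h x) \<in> A"
proof -
  obtain g c where g: "\<And>n. g n \<in> A" "\<And>x. (\<lambda>n. g n x + c n) \<longlonglongrightarrow> f x"
    by (rule approximation[OF f]) blast
  show ?thesis
  proof (rule mem_limit)
    show "(\<lambda>x. g n x * h x + c n * h x) \<in> A" for n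
      by (intro mem_add mem_mult mem_scale g h)
    show "continuous_on UNIV (\<lambda>x. f x * h x)"
      by (intro continuous_on_mult f mem_continuous h)
    show "(\<lambda>n. g n x * h x + c n * h x) \<longlonglongrightarrow> f x * h x" for x
      using tendsto_mult_right[OF g(2), of x "h x"] by (simp add: distrib_right)
  qed
qed

text \<open>As \<open>A\<close> is an ideal, it is enough to find the constant 1 in it. This is the
  pointwise limit of functions in \<open>A\<close> equal to 1 on \<open>C n\<close>, which come from
  a finite cover of \<open>C n\<close>.\<close>

lemma mem_nonvanishing:
  assumes nv: "\<And>x. \<exists>h\<in>A. h x \<noteq> 0" and f: "continuous_on UNIV f"
  shows "f \<in> A"
proof -
  obtain C :: "nat \<Rightarrow> 'a set" where C: "\<And>n. compact (C n)" "\<And>x. \<forall>\<^sub>F n in sequentially. x \<in> C n"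
    by (rule compact_chain) blast
  have "\<exists>h\<in>A. 1 < h x \<and> (\<forall>y. 0 \<le> h y)" for x
  proof -
    obtain h where h: "h \<in> A" "h x \<noteq> 0" using nv by blast
    \<comment> \<open>The square makes the function nonnegative and the factor gives it the value 2
      at \<open>x\<close>.\<close>
    have "(\<lambda>y. 2 / (h x * h x) * (h y * h y)) \<in> A"
      by (intro mem_scale mem_mult h)
    then show ?thesis
      by (rule bexI[rotated]) (use h(2) in simp)
  qed
  then obtain h where h: "\<And>x. h x \<in> A" "\<And>x. 1 < h x x" "\<And>x y. 0 \<le> h x y"
    by metis
  have "\<exists>u\<in>A. \<forall>y\<in>C n. u y = 1" for n
  proof -
    have "open {y. 1 < h x y}" for x
      by (intro open_Collect_less continuous_on_const mem_continuous h)
    moreover have "C n \<subseteq> (\<Union>x\<in>C n. {y. 1 < h x y})"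
      using h(2) by auto
    ultimately obtain D where D: "D \<subseteq> C n" "finite D" "C n \<subseteq> (\<Union>x\<in>D. {y. 1 < h x y})"
      by (rule compactE_image[OF C(1)])
    define k where "k y = (\<Sum>x\<in>D. h x y)" for y
    have k: "k \<in> A"
      unfolding k_def by (intro mem_sum h)
    have k1: "1 < k y" if y: "y \<in> C n" for y
    proof -
      obtain x where x: "x \<in> D" "1 < h x y" using D(3) y by blast
      note x(2)
      also have "h x y \<le> k y"
        unfolding k_def using x D h(3) by (intro member_le_sum) auto
      finally show ?thesis .
    qed
    \<comment> \<open>The denominator is at least 1, so the factor is continuous and
      \<open>mem_ideal\<close> applies; on \<open>C n\<close> it is the reciprocal of
      \<open>k\<close>.\<close>
    have "(\<lambda>y. 1 / max 1 (k y) * k y) \<in> A"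
      by (intro mem_ideal k continuous_intros mem_continuous[OF k]) auto
    then show ?thesis
      by (rule bexI[rotated]) (use k1 in \<open>fastforce simp: max_def\<close>)
  qed
  then obtain u where u: "\<And>n. u n \<in> A" "\<And>n y. y \<in> C n \<Longrightarrow> u n y = 1"
    by metis
  have "(\<lambda>x. 1) \<in> A"
  proof (rule mem_limit[of u])
    show "(\<lambda>n. u n x) \<longlonglongrightarrow> 1" for x
      using C(2)[of x] by (intro tendsto_eventually) (auto elim!: eventually_mono simp: u)
  qed (use u in auto)
  then show ?thesis
    using mem_ideal[OF f] by fastforce
qed

text \<open>At \<open>z\<close> the approximants reduce to \<open>c n\<close>, which therefore tends
  to \<open>f z = 0\<close>, and the functions \<open>g n\<close> alone converge to
  \<open>f\<close>.\<close>

lemma mem_vanishing: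
  assumes van: "\<forall>h\<in>A. h z = 0" and f: "continuous_on UNIV f" "f z = 0"
  shows "f \<in> A"
proof -
  obtain g c where g: "\<And>n. g n \<in> A" "\<And>x. (\<lambda>n. g n x + c n) \<longlonglongrightarrow> f x"
    by (rule approximation[OF f(1)]) blast
  have "g n z = 0" for n
    using van g(1) by blast
  then have c: "c \<longlonglongrightarrow> 0"
    using g(2)[of z] f(2) by simp
  show ?thesis
    using tendsto_diff[OF g(2) c] by (intro mem_limit[OF g(1) f(1)]) simp
qed

section \<open>Extension of the functional to all continuous functions\<close>

text \<open>Otherwise \<open>\<Sum>n. g n / 2 ^ Suc n\<close> has infinite value for suitable \<open>g n\<close>.\<close>

lemma functional_bounded:
  assumes lin: "linear_functional_on A L" and pos: "positive_on A L"
    and van: "\<forall>h\<in>A. h z = 0"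
  obtains M where "\<And>g. g \<in> A \<Longrightarrow> (\<And>x. 0 \<le> g x) \<Longrightarrow> (\<And>x. g x \<le> 1) \<Longrightarrow> L g \<le> M"
proof -
  have "\<exists>M. \<forall>g\<in>A. (\<forall>x. 0 \<le> g x \<and> g x \<le> 1) \<longrightarrow> L g \<le> M"
  proof (rule ccontr)
    assume "\<not> ?thesis"
    \<comment> \<open>The bound is chosen so that the weight \<open>(1/2) ^ Suc n\<close> still
      leaves a value above \<open>n\<close>.\<close>
    then have "\<exists>g\<in>A. (\<forall>x. 0 \<le> g x \<and> g x \<le> 1) \<and> real n * 2 ^ Suc n < L g" for n
      by (meson not_le)
    then obtain g where g: "\<And>n. g n \<in> A" "\<And>n x. 0 \<le> g n x" "\<And>n x. g n x \<le> 1"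
        "\<And>n. real n * 2 ^ Suc n < L (g n)"
      by metis
    define w where "w n x = (1/2) ^ Suc n * g n x" for n x
    have "w n \<in> A" for n
      unfolding w_def by (intro mem_scale g)
    moreover have "0 \<le> w n x" "w n x \<le> (1/2) ^ Suc n" for n x
      using g(2,3)[of n x] by (auto simp: w_def mult_left_le)
    ultimately have w: "w n \<in> A" "0 \<le> w n x" "w n x \<le> (1/2) ^ Suc n" for n x
      by auto
    have sm: "summable (\<lambda>n. (1/2 :: real) ^ Suc n)"
      using power_half_series by (rule sums_summable)
    define G where "G x = (\<Sum>n. w n x)" for x
    have sw: "summable (\<lambda>n. w n x)" for x
      using w by (intro summable_comparison_test'[OF sm, of 0]) auto
    have "uniform_limit UNIV (\<lambda>N x. \<Sum>n<N. w n x) G sequentially"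
      unfolding G_def using w by (intro Weierstrass_m_test[OF _ sm]) auto
    then have cG: "continuous_on UNIV G"
      by (rule uniform_limit_theorem[rotated])
         (auto intro!: always_eventually mem_continuous[OF mem_sum] w)
    \<comment> \<open>All terms vanish at \<open>z\<close>, hence so does \<open>G\<close>; this
      brings \<open>G\<close> into the domain \<open>A\<close> of \<open>L\<close>.\<close>
    have "w n z = 0" for n
      using van w(1) by blast
    then have "G z = 0"
      by (simp add: G_def)
    then have G: "G \<in> A"
      by (rule mem_vanishing[OF van cG])
    have "real n \<le> L G" for n
    proof -
      have "w n x \<le> G x" for x
        using sum_le_suminf[OF sw, of "{n}" x] w(2) by (simp add: G_def)
      then have "0 \<le> L (\<lambda>x. G x + -1 * w n x)"
        using pos mem_add[OF G mem_scale[OF w(1)], of "-1" n] by (auto simp: positive_on_def)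
      also have "\<dots> = L G + -1 * L (w n)"
        using lin G w(1)[of n] mem_scale[OF w(1), of "-1" n] unfolding linear_functional_on_def by metis
      also have "L (w n) = (1/2) ^ Suc n * L (g n)"
        unfolding w_def using lin g(1) unfolding linear_functional_on_def by blast
      finally have "(1/2) ^ Suc n * L (g n) \<le> L G" by simp
      moreover have "(1/2) ^ Suc n * (real n * 2 ^ Suc n) \<le> (1/2) ^ Suc n * L (g n)"
        using g(4)[of n] by (intro mult_left_mono) auto
      ultimately show ?thesis
        by (simp add: power_divide)
    qed
    then show False
      using reals_Archimedean2[of "L G"] by (meson not_le)
  qed
  then show ?thesis
    using that by blast
qed

text \<open>If all of \<open>A\<close> vanishes at \<open>z\<close>, then any constant bounding \<open>L\<close> on the functions of \<open>A\<close> with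
  values in \<open>[0, 1]\<close> can serve as the value of the extension at the constant function 1.\<close>

lemma functional_extension:
  assumes lin: "linear_functional_on A L" and pos: "positive_on A L"
  obtains L' where "linear_functional_on continuous_functions L'" "positive_on continuous_functions L'"
    "\<And>f. f \<in> A \<Longrightarrow> L' f = L f"
proof (cases "\<forall>x. \<exists>h\<in>A. h x \<noteq> 0")
  case True
  then have "A = continuous_functions"
    using mem_nonvanishing mem_continuous by (auto simp: continuous_functions_def)
  then show ?thesis
    using that lin pos by blast
next
  case False
  then obtain z where van: "\<forall>h\<in>A. h z = 0" by blast
  obtain M where M: "\<And>g. g \<in> A \<Longrightarrow> (\<And>x. 0 \<le> g x) \<Longrightarrow> (\<And>x. g x \<le> 1) \<Longrightarrow> L g \<le> M"
    by (rule functional_bounded[OF lin pos van]) blast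
  have add: "L (\<lambda>x. f x + g x) = L f + L g" if "f \<in> A" "g \<in> A" for f g
    using lin that by (auto simp: linear_functional_on_def)
  have scale: "L (\<lambda>x. c * f x) = c * L f" if "f \<in> A" for f c
    using lin that by (auto simp: linear_functional_on_def)
  have mem: "(\<lambda>x. f x - f z) \<in> A" if "continuous_on UNIV f" for f
    using that by (intro mem_vanishing[OF van] continuous_intros) auto
  \<comment> \<open>\<open>f\<close> is split into \<open>f - f z\<close>, which lies in
    \<open>A\<close>, and the constant \<open>f z\<close>.\<close>
  define L' where "L' f = L (\<lambda>x. f x - f z) + M * f z" for f
  show ?thesis
  proof (rule that[of L'])
    show "linear_functional_on continuous_functions L'"
      unfolding linear_functional_on_def
    proof (intro conjI ballI allI)
      fix f g :: "'a \<Rightarrow> real" and c :: real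
      assume f: "f \<in> continuous_functions"
      show "L' (\<lambda>x. c * f x) = c * L' f"
        using scale[OF mem[of f], of c] f by (simp add: L'_def continuous_functions_def algebra_simps)
      assume g: "g \<in> continuous_functions"
      show "L' (\<lambda>x. f x + g x) = L' f + L' g"
        using add[OF mem[of f] mem[of g]] f g by (simp add: L'_def continuous_functions_def algebra_simps)
    qed
    show "positive_on continuous_functions L'"
      unfolding positive_on_def
    proof (intro ballI impI)
      fix f :: "'a \<Rightarrow> real"
      assume "f \<in> continuous_functions" and nn: "\<forall>x. 0 \<le> f x"
      then have f: "continuous_on UNIV f"
        by (simp add: continuous_functions_def)
      show "0 \<le> L' f"
      proof (cases "f z = 0")
        case True
        then show ?thesis
          using pos mem[OF f] nn by (simp add: L'_def positive_on_def)
      next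
        case False
        with nn have z: "0 < f z"
          by (simp add: less_le)
        \<comment> \<open>With this \<open>g\<close>, the function
          \<open>(f - f z) + f z * g\<close> is the positive part of \<open>f - f z\<close>. As
          \<open>g\<close> has values in \<open>[0, 1]\<close>, \<open>L g \<le> M\<close> bounds
          \<open>L\<close> at \<open>f - f z\<close> below by \<open>- f z * M\<close>.\<close>
        define g where "g x = max 0 (1 - f x / f z)" for x
        have g: "g \<in> A"
          unfolding g_def using z by (intro mem_vanishing[OF van] continuous_intros f) auto
        have "L g \<le> M"
          using nn z by (intro M g) (auto simp: g_def)
        moreover have "0 \<le> L (\<lambda>x. (f x - f z) + f z * g x)"
        proof -
          have "0 \<le> (f x - f z) + f z * g x" for x
            using z by (simp add: g_def max_def field_simps)
          then show ?thesis
            using pos mem_add[OF mem[OF f] mem_scale[OF g, of "f z"]] by (simp add: positive_on_def)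
        qed
        then have "0 \<le> L (\<lambda>x. f x - f z) + f z * L g"
          using add[OF mem[OF f] mem_scale[OF g, of "f z"]] scale[OF g] by simp
        ultimately show ?thesis
          using mult_left_mono[OF _ less_imp_le[OF z], of "L g" M] by (simp add: L'_def mult.commute[of _ "f z"])
      qed
    qed
    show "L' f = L f" if "f \<in> A" for f
      using bspec[OF van that] by (simp add: L'_def)
  qed
qed

end

theorem theorem3p8:
  fixes A :: "('a::t2_space \<Rightarrow> real) set"
    and L :: "('a \<Rightarrow> real) \<Rightarrow> real"
  assumes "sigma_compact (UNIV :: 'a set)"
    and "locally_compact_space (euclidean :: 'a topology)"
    and "subalgebra_of_C A"
    and "sigma_complete A"
    and "separates_points A"
    and "linear_functional_on A L"
    and "positive_on A L"
  shows "\<exists>\<mu> :: 'a measure. radon_measure \<mu> \<and> compact (measure_support \<mu>) \<and>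
           (\<forall>f\<in>A. integrable \<mu> f \<and> L f = (\<integral>x. f x \<partial>\<mu>))"
proof -
  obtain C :: "nat \<Rightarrow> 'a set" where C: "\<And>n. compact (C n)" "\<And>n. C n \<subseteq> interior (C (Suc n))" "(\<Union>n. C n) = UNIV"
    by (rule compact_exhaustion[OF assms(1,2)]) blast
  interpret A: sigma_complete_subalgebra A
    using assms by unfold_locales
  obtain L' where lin: "linear_functional_on continuous_functions L'"
      and pos: "positive_on continuous_functions L'" and L': "\<And>f. f \<in> A \<Longrightarrow> L' f = L f"
    by (rule A.functional_extension[OF assms(6,7)]) blast
  obtain n where n: "\<And>f. continuous_on UNIV f \<Longrightarrow> (\<And>x. x \<in> C n \<Longrightarrow> 0 \<le> f x) \<Longrightarrow> 0 \<le> L' f"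
    by (rule positive_functional_concentrated[OF C(2,3) lin pos]) blast
  \<comment> \<open>The choice of \<open>n\<close> supplies positivity tested on \<open>C n\<close>
    only; local compactness supplies the bump functions.\<close>
  interpret R: concentrated_functional L' "C n"
  proof
    show "L' (\<lambda>x. f x + g x) = L' f + L' g" if "continuous_on UNIV f" "continuous_on UNIV g" for f g
      using lin that by (simp add: linear_functional_on_def continuous_functions_def)
    show "L' (\<lambda>x. c * f x) = c * L' f" if "continuous_on UNIV f" for f c
      using lin that by (simp add: linear_functional_on_def continuous_functions_def)
    show "0 \<le> L' f" if "continuous_on UNIV f" "\<And>x. x \<in> C n \<Longrightarrow> 0 \<le> f x" for f
      using that by (rule n)
  qed (rule C(1), rule locally_compact_bump[OF assms(2)])
  show ?thesis
    using R.radon_measure_riesz_measure R.compact_support_riesz_measure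
      R.riesz_representation[OF A.mem_continuous] L'
    by (intro exI[of _ R.riesz_measure]) auto
qed

end
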